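(* Let $n\ge 1$ and let $W_1, W_2, T \in \mathbb{R}^{n\times n}$ be symmetric positive definite matrices. Put $W = W_1 - W_2$ and $A = W + iT \in \mathbb{C}^{n\times n}$, where $i=\sqrt{-1}$, and let $b \in \mathbb{C}^n$. For any initial guess $x^{(0)} \in \mathbb{C}^n$, let the sequence $(x^{(k)})_{k\ge 0}$ be defined by the iteration, for $k = 0,1,2,\ldots$, $$ \begin{cases} (W_1 + iT)\,x^{(k+\frac12)} = W_2\, x^{(k)} + b,\\ (W_2 - iT)\,x^{(k+1)} = W_1\, x^{(k+\frac12)} - b. \end{cases} $$ Then, for every choice of $x^{(0)}$, the sequence $(x^{(k)})_{k\ge 0}$ converges to the exact solution $x$ of the linear system $Ax = (W+iT)x = b$.
   Context: The matrix $W = W_1 - W_2$ is in general symmetric indefinite. Each iteration step consists of solving the two displayed linear systems in turn: the first for the intermediate vector $x^{(k+\frac12)}$ and the second for $x^{(k+1)}$. *)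

theory Defs
  imports "HOL-Analysis.Analysis"
begin

definition spd :: "real ^ 'n ^ 'n \<Rightarrow> bool" where
  "spd M \<longleftrightarrow> transpose M = M \<and> (\<forall>v. v \<noteq> 0 \<longrightarrow> v \<bullet> (M *v v) > 0)"

definition cmat :: "real ^ 'n ^ 'n \<Rightarrow> complex ^ 'n ^ 'n" where
  "cmat M = map_matrix complex_of_real M"

definition imat :: "real ^ 'n ^ 'n \<Rightarrow> complex ^ 'n ^ 'n" where
  "imat M = map_matrix (\<lambda>t. \<i> * complex_of_real t) M"

(* y k is the half-step iterate x^(k+1/2). *)

definition splitting_iteration ::
  "real ^ 'n ^ 'n \<Rightarrow> real ^ 'n ^ 'n \<Rightarrow> real ^ 'n ^ 'n \<Rightarrow> complex ^ 'n \<Rightarrow> complex ^ 'n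
    \<Rightarrow> (nat \<Rightarrow> complex ^ 'n) \<Rightarrow> (nat \<Rightarrow> complex ^ 'n) \<Rightarrow> bool" where
  "splitting_iteration W1 W2 T b x0 x y \<longleftrightarrow>
     x 0 = x0 \<and>
     (\<forall>k. (cmat W1 + imat T) *v y k = cmat W2 *v x k + b \<and>
          (cmat W2 - imat T) *v x (Suc k) = cmat W1 *v y k - b)"

end

theory Submission
  imports Defs
begin

text \<open>
  Let \<open>e\<close> denote the error of \<open>x\<close> and \<open>e'\<close> that of the half-step iterate, so that
  \<open>W1 e' + i T e' = W2 e\<close> and, for the next error \<open>e''\<close>, \<open>W2 e'' - i T e'' = W1 e'\<close>. In the norm
  \<open>\<parallel>u\<parallel>\<^sup>2 = u\<^sup>* T\<inverse> u\<close> the cross terms of \<open>B e \<plusminus> i T e\<close> cancel for symmetric \<open>B\<close>, which leaves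
  \<open>\<parallel>B e \<plusminus> i T e\<parallel>\<^sup>2 = \<parallel>B e\<parallel>\<^sup>2 + e\<^sup>* T e\<close>. This identity makes all matrices involved invertible, and
  applied to both half-steps it gives \<open>\<parallel>W2 e\<parallel>\<^sup>2 \<ge> \<parallel>W2 e''\<parallel>\<^sup>2 + e''\<^sup>* T e''\<close>. Hence the squared norms
  of \<open>W2 e\<close> decrease, their differences tend to \<open>0\<close>, and so do the errors.
\<close>

section \<open>Real and imaginary parts, Hermitian forms\<close>

definition re_vec :: "complex ^ 'n \<Rightarrow> real ^ 'n" where
  "re_vec x = (\<chi> i. Re (x $ i))"

definition im_vec :: "complex ^ 'n \<Rightarrow> real ^ 'n" where
  "im_vec x = (\<chi> i. Im (x $ i))"

text \<open>For symmetric \<open>M\<close> this is the Hermitian form \<open>x\<^sup>* M x\<close>.\<close>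

definition herm_form :: "real ^ 'n ^ 'n \<Rightarrow> complex ^ 'n \<Rightarrow> real" where
  "herm_form M x = re_vec x \<bullet> (M *v re_vec x) + im_vec x \<bullet> (M *v im_vec x)"

lemma re_im_vec_add_diff [simp]:
  "re_vec (x + y) = re_vec x + re_vec y" "im_vec (x + y) = im_vec x + im_vec y"
  "re_vec (x - y) = re_vec x - re_vec y" "im_vec (x - y) = im_vec x - im_vec y"
  "re_vec 0 = 0" "im_vec 0 = 0"
  by (simp_all add: re_vec_def im_vec_def vec_eq_iff)

lemma re_im_vec_mult [simp]:
  "re_vec (cmat M *v x) = M *v re_vec x" "im_vec (cmat M *v x) = M *v im_vec x"
  "re_vec (imat M *v x) = - (M *v im_vec x)" "im_vec (imat M *v x) = M *v re_vec x"
  by (simp_all add: re_vec_def im_vec_def cmat_def imat_def map_matrix_def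
      matrix_vector_mult_def vec_eq_iff sum_negf)

lemma norm_complex_vec_squared: "(norm x)\<^sup>2 = re_vec x \<bullet> re_vec x + im_vec x \<bullet> im_vec x"
  by (simp add: norm_vec_def L2_set_def sum_nonneg re_vec_def im_vec_def inner_vec_def
      cmod_power2 sum.distrib flip: power2_eq_square)

section \<open>Symmetric and positive definite matrices\<close>

lemma inner_sym_matrix:
  assumes "transpose M = M"
  shows "(M *v u) \<bullet> v = u \<bullet> (M *v (v :: real ^ 'n))"
  by (metis assms dot_lmul_matrix transpose_matrix_vector)

text \<open>The minimum of the quadratic form over the compact unit sphere is positive; homogeneity
  of degree two carries the bound to all vectors.\<close>

lemma spd_coercive:
  fixes T :: "real ^ 'n ^ 'n"
  assumes "spd T"
  obtains c where "c > 0" "\<And>v. c * (v \<bullet> v) \<le> v \<bullet> (T *v v)"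
proof -
  have "continuous_on (sphere 0 1) (\<lambda>v. v \<bullet> (T *v v))"
    by (intro continuous_intros linear_continuous_on linear_linear[THEN iffD2]
        matrix_vector_mul_linear)
  \<comment> \<open>A unit vector shows that the sphere is nonempty, so the minimum is
    attained.\<close>
  moreover have "axis (undefined :: 'n) 1 \<in> sphere (0 :: real ^ 'n) 1"
    by (simp add: norm_axis_1)
  ultimately obtain w where w: "w \<in> sphere (0 :: real ^ 'n) 1"
      and min: "\<And>v. v \<in> sphere 0 1 \<Longrightarrow> w \<bullet> (T *v w) \<le> v \<bullet> (T *v v)"
    using continuous_attains_inf[of "sphere (0 :: real ^ 'n) 1"] compact_sphere by blast
  show thesis
  proof
    show "w \<bullet> (T *v w) > 0"
      using assms w by (metis dist_0_norm mem_sphere norm_zero spd_def zero_neq_one)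
    show "w \<bullet> (T *v w) * (v \<bullet> v) \<le> v \<bullet> (T *v v)" for v
    proof (cases "v = 0")
      case False
      then have "w \<bullet> (T *v w) \<le> (v /\<^sub>R norm v) \<bullet> (T *v (v /\<^sub>R norm v))"
        by (intro min) simp
      also have "\<dots> = v \<bullet> (T *v v) / (norm v)\<^sup>2"
        by (simp add: matrix_vector_mult_scaleR power2_eq_square field_simps)
      finally show ?thesis
        using False by (simp add: pos_le_divide_eq power2_norm_eq_inner)
    qed simp
  qed
qed

lemma herm_form_coercive:
  assumes "spd T"
  obtains c where "c > 0" "\<And>x. c * (norm x)\<^sup>2 \<le> herm_form T x"
proof -
  from assms obtain c where "c > 0" and c: "\<And>v. c * (v \<bullet> v) \<le> v \<bullet> (T *v v)"
    by (rule spd_coercive) blast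
  have "c * (norm x)\<^sup>2 \<le> herm_form T x" for x
    using c[of "re_vec x"] c[of "im_vec x"]
    by (simp add: norm_complex_vec_squared herm_form_def distrib_left)
  with \<open>c > 0\<close> show thesis by (rule that)
qed

text \<open>Positive definiteness leaves \<open>T\<close> a trivial kernel. With
  \<open>u = S v\<close>, the value \<open>v \<bullet> S v\<close> equals
  \<open>u \<bullet> T u\<close>, so positivity passes to \<open>S\<close>.\<close>

lemma spd_inverse:
  fixes T :: "real ^ 'n ^ 'n"
  assumes "spd T"
  obtains S where "T ** S = mat 1" "spd S"
proof -
  have "\<forall>v. T *v v = 0 \<longrightarrow> v = 0"
    using assms by (metis inner_zero_right less_irrefl spd_def)
  then obtain S where ST: "S ** T = mat 1"
    using matrix_left_invertible_ker by blast
  then have TS: "T ** S = mat 1"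
    by (simp add: matrix_left_right_inverse)
  have "transpose S = S"
  proof -
    have "transpose S ** T = mat 1"
      using TS assms by (metis matrix_transpose_mul spd_def transpose_mat)
    then show ?thesis
      using TS by (metis matrix_mul_assoc matrix_mul_lid matrix_mul_rid)
  qed
  moreover have "v \<bullet> (S *v v) > 0" if "v \<noteq> 0" for v
  proof -
    have v: "T *v (S *v v) = v"
      by (simp add: matrix_vector_mul_assoc TS)
    with that have "S *v v \<noteq> 0"
      by auto
    then have "(S *v v) \<bullet> (T *v (S *v v)) > 0"
      using assms by (simp add: spd_def)
    with v show ?thesis by (simp add: inner_commute)
  qed
  ultimately show thesis
    using that TS by (simp add: spd_def)
qed

lemma herm_form_nonneg: "spd S \<Longrightarrow> herm_form S x \<ge> 0"
  by (rule herm_form_coercive[of S], assumption)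
    (meson less_imp_le mult_nonneg_nonneg order_trans zero_le_power2)

text \<open>The Pythagorean identity with respect to \<open>S = T\<inverse>\<close>.\<close>

lemma herm_form_split:
  fixes B T S :: "real ^ 'n ^ 'n"
  assumes B: "transpose B = B" and T: "transpose T = T" and S: "transpose S = S"
    and TS: "T ** S = mat 1"
  shows "herm_form S ((cmat B + imat T) *v x) = herm_form S (cmat B *v x) + herm_form T x"
    and "herm_form S ((cmat B - imat T) *v x) = herm_form S (cmat B *v x) + herm_form T x"
proof -
  have inv: "S *v (T *v v) = v" "T *v (S *v v) = v" for v
    using TS matrix_left_right_inverse[of T S] by (simp_all add: matrix_vector_mul_assoc)
  \<comment> \<open>Once \<open>S\<close> cancels \<open>T\<close>, the cross terms are these two
    products with opposite signs.\<close>
  have *: "im_vec x \<bullet> (B *v re_vec x) = re_vec x \<bullet> (B *v im_vec x)"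
    by (metis inner_sym_matrix[OF B] inner_commute)
  show "herm_form S ((cmat B + imat T) *v x) = herm_form S (cmat B *v x) + herm_form T x"
    and "herm_form S ((cmat B - imat T) *v x) = herm_form S (cmat B *v x) + herm_form T x"
    by (simp_all add: herm_form_def matrix_vector_mult_add_rdistrib
        matrix_vector_mult_diff_rdistrib matrix_vector_mult_diff_distrib
        matrix_vector_right_distrib inner_add_left inner_add_right
        inner_diff_left inner_diff_right inv * inner_sym_matrix[OF T] inner_sym_matrix[OF B])
qed

text \<open>On a kernel vector the Pythagorean identity writes 0 as a sum of two nonnegative terms,
  and coercivity of \<open>T\<close> makes the vector vanish. Symmetry of \<open>B\<close> covers
  \<open>W1\<close>, \<open>W2\<close> and the possibly indefinite \<open>W\<close> alike.\<close>

lemma cmat_imat_invertible: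
  fixes B T :: "real ^ 'n ^ 'n"
  assumes B: "transpose B = B" and "spd T" and M: "M = cmat B + imat T \<or> M = cmat B - imat T"
  shows "invertible M"
proof -
  obtain S where TS: "T ** S = mat 1" and S: "spd S"
    using \<open>spd T\<close> by (rule spd_inverse)
  obtain c where "c > 0" and c: "\<And>x. c * (norm x)\<^sup>2 \<le> herm_form T x"
    using \<open>spd T\<close> by (rule herm_form_coercive) blast
  have "x = 0" if "M *v x = 0" for x
  proof -
    have "0 = herm_form S (M *v x)"
      using that by (simp add: herm_form_def)
    also have "\<dots> = herm_form S (cmat B *v x) + herm_form T x"
      using M herm_form_split[OF B _ _ TS, of x] \<open>spd T\<close> S by (auto simp: spd_def)
    finally have "c * (norm x)\<^sup>2 \<le> 0"
      using herm_form_nonneg[OF S, of "cmat B *v x"] c[of x] by linarith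
    with \<open>c > 0\<close> show "x = 0"
      by (simp add: mult_le_0_iff)
  qed
  then show ?thesis
    using matrix_left_invertible_ker invertible_left_inverse by blast
qed

text \<open>As an equivalence this rewrites an implicit linear system into an explicit formula,
  giving existence and uniqueness at once.\<close>

lemma invertible_solve:
  fixes M :: "complex ^ 'n ^ 'n"
  assumes "invertible M"
  obtains P where "\<And>u r. M *v u = r \<longleftrightarrow> u = P *v r"
proof -
  from assms obtain P where "M ** P = mat 1" "P ** M = mat 1"
    by (auto simp: invertible_def)
  then have "M *v u = r \<longleftrightarrow> u = P *v r" for u r
    by (metis matrix_vector_mul_assoc matrix_vector_mul_lid)
  then show thesis by (rule that)
qed

lemma splitting_iteration_ex1:
  assumes "invertible (cmat W1 + imat T)" "invertible (cmat W2 - imat T)"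
  shows "\<exists>!(x, y). splitting_iteration W1 W2 T b x0 x y"
proof -
  obtain P where P: "\<And>u r. (cmat W1 + imat T) *v u = r \<longleftrightarrow> u = P *v r"
    using assms(1) by (rule invertible_solve) blast
  obtain Q where Q: "\<And>u r. (cmat W2 - imat T) *v u = r \<longleftrightarrow> u = Q *v r"
    using assms(2) by (rule invertible_solve) blast
  \<comment> \<open>With both systems solved, \<open>x\<close> is the orbit of \<open>x0\<close>
    under one map and \<open>y\<close> is read off from \<open>x\<close>.\<close>
  define half where "half u = P *v (cmat W2 *v u + b)" for u
  define next_it where "next_it u = Q *v (cmat W1 *v half u - b)" for u
  have "splitting_iteration W1 W2 T b x0 x y
      \<longleftrightarrow> x = (\<lambda>k. (next_it ^^ k) x0) \<and> y = (\<lambda>k. half ((next_it ^^ k) x0))" for x y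
  proof -
    have "splitting_iteration W1 W2 T b x0 x y
        \<longleftrightarrow> (x 0 = x0 \<and> (\<forall>k. x (Suc k) = next_it (x k))) \<and> (\<forall>k. y k = half (x k))"
      by (auto simp: splitting_iteration_def P Q half_def next_it_def)
    also have "x 0 = x0 \<and> (\<forall>k. x (Suc k) = next_it (x k)) \<longleftrightarrow> x = (\<lambda>k. (next_it ^^ k) x0)"
    proof
      assume *: "x 0 = x0 \<and> (\<forall>k. x (Suc k) = next_it (x k))"
      have "x k = (next_it ^^ k) x0" for k
        using * by (induction k) auto
      then show "x = (\<lambda>k. (next_it ^^ k) x0)" by blast
    qed simp
    finally show ?thesis by auto
  qed
  then show ?thesis by auto
qed

text \<open>The exact solution is a fixed point of both half-steps, so subtracting its equations
  removes \<open>b\<close>.\<close>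

lemma splitting_iteration_error:
  assumes A: "(cmat (W1 - W2) + imat T) *v z = b"
    and it: "splitting_iteration W1 W2 T b x0 x y"
  shows "(cmat W1 + imat T) *v (y k - z) = cmat W2 *v (x k - z)"
    and "(cmat W2 - imat T) *v (x (Suc k) - z) = cmat W1 *v (y k - z)"
proof -
  have "cmat (W1 - W2) = cmat W1 - cmat W2"
    by (simp add: cmat_def map_matrix_def vec_eq_iff)
  then have b: "b = cmat W1 *v z - cmat W2 *v z + imat T *v z"
    using A by (simp add: matrix_vector_mult_add_rdistrib matrix_vector_mult_diff_rdistrib)
  have "(cmat W1 + imat T) *v y k = cmat W2 *v x k + b"
    and "(cmat W2 - imat T) *v x (Suc k) = cmat W1 *v y k - b"
    using it by (auto simp: splitting_iteration_def)
  then show "(cmat W1 + imat T) *v (y k - z) = cmat W2 *v (x k - z)"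
    and "(cmat W2 - imat T) *v (x (Suc k) - z) = cmat W1 *v (y k - z)"
    by (simp_all add: b matrix_vector_mult_add_rdistrib matrix_vector_mult_diff_rdistrib
        matrix_vector_mult_diff_distrib algebra_simps)
qed

lemma splitting_iteration_converges:
  assumes W1: "transpose W1 = W1" and W2: "transpose W2 = W2" and T: "spd T"
    and A: "(cmat (W1 - W2) + imat T) *v z = b"
    and it: "splitting_iteration W1 W2 T b x0 x y"
  shows "x \<longlonglongrightarrow> z"
proof -
  obtain S where TS: "T ** S = mat 1" and S: "spd S"
    using T by (rule spd_inverse)
  obtain c where "c > 0" and c: "\<And>x. c * (norm x)\<^sup>2 \<le> herm_form T x"
    using T by (rule herm_form_coercive) blast
  define f where "f k = herm_form S (cmat W2 *v (x k - z))" for k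
  \<comment> \<open>The error equation, read backwards, turns \<open>W2 e\<close> into
    \<open>(W1 + iT) e'\<close>, which the Pythagorean identity splits.\<close>
  have "f k = herm_form S (cmat W1 *v (y k - z)) + herm_form T (y k - z)" for k
    using splitting_iteration_error(1)[OF A it] herm_form_split(1)[OF W1 _ _ TS] S T
    by (simp add: f_def spd_def flip: splitting_iteration_error(1)[OF A it])
  moreover have "herm_form S (cmat W1 *v (y k - z)) = f (Suc k) + herm_form T (x (Suc k) - z)" for k
    using herm_form_split(2)[OF W2 _ _ TS] S T
    by (simp add: f_def spd_def flip: splitting_iteration_error(2)[OF A it])
  \<comment> \<open>The two equalities are chained and the nonnegative half-step term in
    \<open>T\<close> is dropped.\<close>
  ultimately have step: "c * (norm (x (Suc k) - z))\<^sup>2 \<le> f k - f (Suc k)" for k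
    using herm_form_nonneg[OF T, of "y k - z"] c[of "x (Suc k) - z"] by (smt (verit))
  have "decseq f"
  proof (rule decseq_SucI)
    fix k
    have "0 \<le> c * (norm (x (Suc k) - z))\<^sup>2"
      using \<open>c > 0\<close> by simp
    with step[of k] show "f (Suc k) \<le> f k" by linarith
  qed
  moreover have "0 \<le> f k" for k
    using herm_form_nonneg[OF S] by (simp add: f_def)
  ultimately obtain L where "f \<longlonglongrightarrow> L"
    using decseq_convergent by metis
  \<comment> \<open>By \<open>step\<close>, these quotients bound the squared errors from
    above.\<close>
  then have "(\<lambda>k. (f k - f (Suc k)) / c) \<longlonglongrightarrow> (L - L) / c"
    using \<open>c > 0\<close> by (intro tendsto_intros LIMSEQ_Suc) auto
  then have "(\<lambda>k. (f k - f (Suc k)) / c) \<longlonglongrightarrow> 0"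
    by simp
  then have "(\<lambda>k. (norm (x (Suc k) - z))\<^sup>2) \<longlonglongrightarrow> 0"
    by (rule tendsto_sandwich[rotated 3, OF _ ])
      (use step \<open>c > 0\<close> in \<open>auto simp: pos_le_divide_eq mult.commute\<close>)
  then have "(\<lambda>k. norm (x (Suc k) - z)) \<longlonglongrightarrow> 0"
    by (simp add: tendsto_power_zero)
  then show ?thesis
    by (simp add: tendsto_norm_zero_iff LIM_zero_iff filterlim_sequentially_Suc)
qed

theorem theorem1:
  fixes W1 W2 T W :: "real ^ 'n ^ 'n"
    and A :: "complex ^ 'n ^ 'n"
    and b :: "complex ^ 'n"
  assumes "spd W1" and "spd W2" and "spd T"
    and "W = W1 - W2"
    and "A = cmat W + imat T"
  shows "(\<exists>!z. A *v z = b) \<and>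
    (\<forall>x0. (\<exists>!(x, y). splitting_iteration W1 W2 T b x0 x y) \<and>
      (\<forall>x y. splitting_iteration W1 W2 T b x0 x y \<longrightarrow>
        x \<longlonglongrightarrow> (THE z. A *v z = b)))"
proof -
  have sym: "transpose W1 = W1" "transpose W2 = W2"
    using assms by (auto simp: spd_def)
  \<comment> \<open>Although \<open>W\<close> may be indefinite, its symmetry makes \<open>A\<close>
    invertible, so the \<open>THE\<close> term denotes the solution.\<close>
  then have "transpose W = W"
    using assms(4) by (simp add: transpose_def vec_eq_iff)
  then have "invertible A"
    using cmat_imat_invertible assms(3,5) by blast
  then obtain P where P: "\<And>u r. A *v u = r \<longleftrightarrow> u = P *v r"
    by (rule invertible_solve) blast
  then have sol: "\<exists>!z. A *v z = b" by simp
  have the: "(cmat (W1 - W2) + imat T) *v (THE z. A *v z = b) = b"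
    using theI'[OF sol] assms(4,5) by simp
  show ?thesis
  proof (intro conjI allI impI)
    show "\<exists>!z. A *v z = b" by (fact sol)
    show "\<exists>!(x, y). splitting_iteration W1 W2 T b x0 x y" for x0
      using sym assms(3) cmat_imat_invertible by (intro splitting_iteration_ex1) blast+
    show "x \<longlonglongrightarrow> (THE z. A *v z = b)"
      if "splitting_iteration W1 W2 T b x0 x y" for x0 x y
      using sym assms(3) the that by (rule splitting_iteration_converges)
  qed
qed

end
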